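(* There are infinitely many (pairwise non-isomorphic) $4$-connected planar graphs $G$ with $m_4(G)=|V(G)|-5$, and infinitely many (pairwise non-isomorphic) $3$-colorable planar graphs $G$ with $m_3(G)=|V(G)|-3$.
   Context: All graphs are finite and simple. A $k$-coloring of $G$ is a map $V(G)\to\{1,\dots,k\}$; it is proper if adjacent vertices receive distinct colors; $G$ is $k$-colorable if it has a proper $k$-coloring. A $2$CC transversal with respect to a proper coloring $\varphi$ of $G$ is a set $E' \subseteq E(G)$ that intersects every cycle of $G$ whose vertices use only two colors. For a positive integer $k$, $m_k(G)$ is the minimum of $|E'|$ over all proper $k$-colorings $\varphi$ of $G$ and all $2$CC transversals $E'$ with respect to $\varphi$ (with $m_k(G)=\infty$ if $G$ has no proper $k$-coloring). *)

theory Defs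
  imports "HOL-Analysis.Analysis"
begin

record 'a ugraph =
  verts :: "'a set"
  edges :: "'a set set"

definition simple_graph :: "'a ugraph \<Rightarrow> bool" where
  "simple_graph G \<longleftrightarrow>
     finite (verts G) \<and> (\<forall>e\<in>edges G. e \<subseteq> verts G \<and> card e = 2)"

definition graph_iso :: "'a ugraph \<Rightarrow> 'b ugraph \<Rightarrow> bool" where
  "graph_iso G H \<longleftrightarrow>
     (\<exists>f. bij_betw f (verts G) (verts H) \<and>
          (\<forall>u\<in>verts G. \<forall>v\<in>verts G. {u, v} \<in> edges G \<longleftrightarrow> {f u, f v} \<in> edges H))"

definition proper_coloring :: "'a ugraph \<Rightarrow> nat \<Rightarrow> ('a \<Rightarrow> nat) \<Rightarrow> bool" where
  "proper_coloring G k \<phi> \<longleftrightarrow>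
     \<phi> \<in> verts G \<rightarrow> {1..k} \<and>
     (\<forall>u\<in>verts G. \<forall>v\<in>verts G. {u, v} \<in> edges G \<longrightarrow> \<phi> u \<noteq> \<phi> v)"

definition colorable :: "'a ugraph \<Rightarrow> nat \<Rightarrow> bool" where
  "colorable G k \<longleftrightarrow> (\<exists>\<phi>. proper_coloring G k \<phi>)"

definition cycle_edges :: "'a list \<Rightarrow> 'a set set" where
  "cycle_edges c = {{c ! i, c ! (Suc i mod length c)} | i. i < length c}"

definition cycle :: "'a ugraph \<Rightarrow> 'a list \<Rightarrow> bool" where
  "cycle G c \<longleftrightarrow>
     3 \<le> length c \<and> distinct c \<and> set c \<subseteq> verts G \<and> cycle_edges c \<subseteq> edges G"

definition two_cc_transversal :: "'a ugraph \<Rightarrow> ('a \<Rightarrow> nat) \<Rightarrow> 'a set set \<Rightarrow> bool" where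
  "two_cc_transversal G \<phi> E' \<longleftrightarrow>
     E' \<subseteq> edges G \<and>
     (\<forall>c. cycle G c \<and> card (\<phi> ` set c) = 2 \<longrightarrow> E' \<inter> cycle_edges c \<noteq> {})"

text \<open>The infimum of a nonempty set in \<^typ>\<open>enat\<close> is attained, and the infimum of the
  empty set is infinity, so this is the minimum with the convention for non-colorable graphs.\<close>

definition two_cc_number :: "nat \<Rightarrow> 'a ugraph \<Rightarrow> enat" where
  "two_cc_number k G = Inf {enat (card E') | \<phi> E'. proper_coloring G k \<phi> \<and> two_cc_transversal G \<phi> E'}"

definition graph_connected :: "'a ugraph \<Rightarrow> bool" where
  "graph_connected G \<longleftrightarrow>
     verts G \<noteq> {} \<and>
     (\<forall>u\<in>verts G. \<forall>v\<in>verts G. (u, v) \<in> {(x, y). {x, y} \<in> edges G}\<^sup>*)"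

definition remove_verts :: "'a ugraph \<Rightarrow> 'a set \<Rightarrow> 'a ugraph" where
  "remove_verts G X = \<lparr>verts = verts G - X, edges = {e \<in> edges G. e \<inter> X = {}}\<rparr>"

definition k_connected :: "nat \<Rightarrow> 'a ugraph \<Rightarrow> bool" where
  "k_connected k G \<longleftrightarrow>
     k < card (verts G) \<and>
     (\<forall>X\<subseteq>verts G. card X < k \<longrightarrow> graph_connected (remove_verts G X))"

text \<open>A drawing in the plane: \<open>p\<close> places the vertices, and each edge \<open>e\<close> is drawn as an arc
  \<open>\<gamma> e\<close> between its ends whose interior \<open>path_image (\<gamma> e) - p ` e\<close> meets no vertex and no
  other edge.\<close>

definition plane_drawing ::
  "'a ugraph \<Rightarrow> ('a \<Rightarrow> complex) \<Rightarrow> ('a set \<Rightarrow> real \<Rightarrow> complex) \<Rightarrow> bool" where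
  "plane_drawing G p \<gamma> \<longleftrightarrow>
     inj_on p (verts G) \<and>
     (\<forall>e\<in>edges G.
        arc (\<gamma> e) \<and> {pathstart (\<gamma> e), pathfinish (\<gamma> e)} = p ` e \<and>
        (path_image (\<gamma> e) - p ` e) \<inter> p ` verts G = {} \<and>
        (\<forall>f\<in>edges G. f \<noteq> e \<longrightarrow> (path_image (\<gamma> e) - p ` e) \<inter> path_image (\<gamma> f) = {}))"

definition planar :: "'a ugraph \<Rightarrow> bool" where
  "planar G \<longleftrightarrow> (\<exists>p \<gamma>. plane_drawing G p \<gamma>)"

end

theory Submission imports Defs
begin

text \<open>
  Both families consist of double wheels: a rim cycle with \<open>m\<close> vertices, and two non-adjacent hubs,
  each joined to every rim vertex. Odd \<open>m \<ge> 5\<close> gives the 4-connected graphs and even \<open>m \<ge> 4\<close> gives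
  the 3-colourable ones.

  The parity is chosen so that colours are scarce. An odd rim needs three colours, so with four
  colours in total only one is left for the hubs; an even rim needs two colours, so with three in
  total again only one is left. In every proper colouring the two hubs therefore share a colour
  and the rim uses exactly \<open>k - 1\<close> colours (\<open>hubs_share_colour\<close>).

  Given this, two rim vertices \<open>u\<close>, \<open>v\<close> of the same colour form with the hubs a 4-cycle in two colours.
  A transversal must contain one of its four spokes, so in each of the \<open>k - 1\<close> rim colours at most
  one vertex has no spoke in the transversal, and at least \<open>m - (k - 1)\<close> spokes are used
  (\<open>card_spokes_in_transversal\<close>). For \<open>k = 3\<close> the rim itself is one more cycle in two colours, disjoint
  from all spokes, and costs one more edge. With \<open>m + 2\<close> vertices the bounds are \<open>m - 3\<close>, which is
  five less than the order, and \<open>m - 1\<close>, which is three less.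

  The bounds are attained by taking all spokes at one hub except one per rim colour, and for
  \<open>k = 3\<close> also one rim edge. A two-coloured cycle through a hub has only hubs and rim vertices of a
  single colour, so it alternates between them and each of its rim vertices is joined in it to both
  hubs; a hub has two such neighbours of the same colour, and one of them has its spoke in the set
  (\<open>avoiding_cycle_in_rim\<close>). A cycle that avoids the hubs is the whole rim (\<open>rim_cycle_unique\<close>),
  which is hit by the rim edge for \<open>k = 3\<close> and has three colours for \<open>k = 4\<close>.

  Planarity is shown by an explicit drawing with the rim vertices on the real axis.
\<close>

section \<open>Double wheels\<close>

text \<open>The rim vertices are \<open>0, \<dots>, m - 1\<close> and the hubs are \<open>m\<close> and \<open>m + 1\<close>.\<close>

definition double_wheel :: "nat \<Rightarrow> nat ugraph" where
  "double_wheel m =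
     \<lparr>verts = {..<m + 2},
      edges = cycle_edges [0..<m] \<union> {{v, h} | v h. v < m \<and> h \<in> {m, m + 1}}\<rparr>"

lemma verts_double_wheel [simp]: "verts (double_wheel m) = {..<m + 2}"
  by (simp add: double_wheel_def)

lemma mem_rim_edges: "e \<in> cycle_edges [0..<m] \<longleftrightarrow> (\<exists>i<m. e = {i, Suc i mod m})"
proof -
  have "e \<in> cycle_edges [0..<m] \<longleftrightarrow>
      (\<exists>i. i < m \<and> e = {[0..<m] ! i, [0..<m] ! (Suc i mod m)})"
    unfolding cycle_edges_def by auto
  also have "\<dots> \<longleftrightarrow> (\<exists>i. i < m \<and> e = {i, Suc i mod m})"
    by (rule ex_cong1, rule conj_cong) simp_all
  finally show ?thesis .
qed

lemma rim_edge_subset: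
  assumes "e \<in> cycle_edges [0..<m]"
  shows "e \<subseteq> {..<m}"
proof -
  obtain i where "i < m" "e = {i, Suc i mod m}"
    using assms unfolding mem_rim_edges by blast
  moreover from this have "Suc i mod m < m"
    by (intro mod_less_divisor) simp
  ultimately show ?thesis
    by simp
qed

lemma mem_edges_double_wheel:
  "e \<in> edges (double_wheel m) \<longleftrightarrow>
     (\<exists>i<m. e = {i, Suc i mod m}) \<or> (\<exists>i<m. e = {i, m} \<or> e = {i, m + 1})"
  by (auto simp: double_wheel_def mem_rim_edges)

lemma spoke_in_edges:
  "v < m \<Longrightarrow> {v, m} \<in> edges (double_wheel m)"
  "v < m \<Longrightarrow> {v, Suc m} \<in> edges (double_wheel m)"
  "v < m \<Longrightarrow> {m, v} \<in> edges (double_wheel m)"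
  "v < m \<Longrightarrow> {Suc m, v} \<in> edges (double_wheel m)"
  by (auto simp: mem_edges_double_wheel)

lemma rim_edge_in_edges:
  "v < m \<Longrightarrow> {v, Suc v mod m} \<in> edges (double_wheel m)"
  by (auto simp: mem_edges_double_wheel)

lemma Suc_mod_ne: "i < m \<Longrightarrow> 2 \<le> m \<Longrightarrow> Suc i mod m \<noteq> i"
  by (cases "Suc i = m") auto

lemma simple_double_wheel:
  assumes "3 \<le> m"
  shows "simple_graph (double_wheel m)"
proof -
  have "e \<subseteq> {..<m + 2} \<and> card e = 2" if "e \<in> edges (double_wheel m)" for e
  proof -
    obtain i j where "i < m" "j < m + 2" "j \<noteq> i" "e = {i, j}"
    proof -
      have rim: "Suc i mod m < m + 2 \<and> Suc i mod m \<noteq> i" if "i < m" for i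
        using assms Suc_mod_ne[OF that] mod_less_divisor[of m "Suc i"] by linarith
      consider i where "i < m" "e = {i, Suc i mod m}" | i where "i < m" "e = {i, m} \<or> e = {i, m + 1}"
        using \<open>e \<in> edges (double_wheel m)\<close> unfolding mem_edges_double_wheel by blast
      then show thesis
      proof cases
        case (1 i)
        show thesis
          using that[OF 1(1) _ _ 1(2)] rim[OF 1(1)] by blast
      next
        case (2 i)
        then show thesis
          using that[of i m] that[of i "m + 1"] by auto
      qed
    qed
    then show ?thesis
      by simp
  qed
  then show ?thesis
    by (simp add: simple_graph_def)
qed

lemma rim_neighbours:
  assumes "u < m" "v < m" "{u, v} \<in> edges (double_wheel m)"
  shows "v = Suc u mod m \<or> u = Suc v mod m"
proof -
  obtain i where "{u, v} = {i, Suc i mod m}"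
    using assms unfolding mem_edges_double_wheel by (auto simp: doubleton_eq_iff)
  then show ?thesis
    unfolding doubleton_eq_iff by blast
qed

lemma hub_neighbour:
  assumes "3 \<le> m" "{h, v} \<in> edges (double_wheel m)" "m \<le> h"
  shows "v < m" "h = m \<or> h = Suc m"
proof -
  have "Suc i mod m < m" for i
    using assms(1) by simp
  then have "\<not> (\<exists>i<m. {h, v} = {i, Suc i mod m})"
    using assms(3) by (metis insertI1 insert_iff singletonD not_less)
  then obtain i where "i < m" "{h, v} = {i, m} \<or> {h, v} = {i, m + 1}"
    using assms(2) unfolding mem_edges_double_wheel by blast
  then show "v < m" "h = m \<or> h = Suc m"
    using assms(3) by (auto simp: doubleton_eq_iff)
qed

lemma rim_is_cycle:
  assumes "3 \<le> m"
  shows "cycle (double_wheel m) [0..<m]"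
  using assms by (auto simp: cycle_def double_wheel_def)

section \<open>Planarity\<close>

text \<open>The drawing has the rim vertices on the real axis, spaced evenly and symmetrically about \<open>0\<close>, and
  the hubs at \<open>\<i>\<close> and \<open>- \<i>\<close>. Every edge is a segment except the rim edge between the two ends
  of the axis, which goes over the upper hub through the point \<open>2 \<i>\<close>.\<close>

definition place :: "nat \<Rightarrow> nat \<Rightarrow> complex" where
  "place m v =
     (if v < m then complex_of_real (2 * real v - (real m - 1))
      else if v = m then \<i> else - \<i>)"

definition draw_edge :: "nat \<Rightarrow> nat set \<Rightarrow> real \<Rightarrow> complex" where
  "draw_edge m e =
     (if e = {0, m - 1}
      then linepath (place m 0) (2 * \<i>) +++ linepath (2 * \<i>) (place m (m - 1))
      else linepath (place m (Min e)) (place m (Max e)))"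

lemma double_wheel_edge_cases:
  assumes "e \<in> edges (double_wheel m)" "3 \<le> m"
  obtains (upper) i where "i < m" "e = {i, m}"
  | (lower) i where "i < m" "e = {i, Suc m}"
  | (axis) i where "Suc i < m" "e = {i, Suc i}"
  | (closing) "e = {0, m - 1}"
proof -
  consider i where "i < m" "e = {i, Suc i mod m}" | i where "i < m" "e = {i, m} \<or> e = {i, Suc m}"
    using assms(1) by (auto simp: mem_edges_double_wheel)
  then show thesis
  proof cases
    case (1 i)
    then show thesis
    proof (cases "Suc i = m")
      case True
      then show thesis
        using 1 by (intro closing) auto
    next
      case False
      then show thesis
        using 1 by (intro axis[of i]) auto
    qed
  next
    case (2 i)
    then show thesis
      using upper lower by blast
  qed
qed

lemma draw_edge_simps:
  assumes "3 \<le> m"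
  shows "i < m \<Longrightarrow> draw_edge m {i, m} = linepath (place m i) \<i>"
    and "i < m \<Longrightarrow> draw_edge m {i, Suc m} = linepath (place m i) (- \<i>)"
    and "Suc i < m \<Longrightarrow> draw_edge m {i, Suc i} = linepath (place m i) (place m (Suc i))"
    and "draw_edge m {0, m - 1} =
           linepath (place m 0) (2 * \<i>) +++ linepath (2 * \<i>) (place m (m - 1))"
  using assms by (auto simp: draw_edge_def doubleton_eq_iff place_def)

lemma Re_place: "Re (place m v) = (if v < m then 2 * real v - (real m - 1) else 0)"
  and Im_place: "Im (place m v) = (if v < m then 0 else if v = m then 1 else - 1)"
  by (auto simp: place_def)

lemma inj_on_place: "inj_on (place m) {..<m + 2}"
  by (auto simp: inj_on_def complex_eq_iff Re_place Im_place split: if_splits)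

lemma eq_place_iff:
  "v < m \<Longrightarrow> z = place m v \<longleftrightarrow> Im z = 0 \<and> Re z = 2 * real v - (real m - 1)"
  "z = place m m \<longleftrightarrow> Re z = 0 \<and> Im z = 1"
  "z = place m (Suc m) \<longleftrightarrow> Re z = 0 \<and> Im z = - 1"
  by (auto simp: complex_eq_iff Re_place Im_place)

text \<open>Equations and inequalities that confine each arc tightly enough to decide all intersections by
  arithmetic. The bent edge lies on the boundary of the rhombus with corners \<open>\<plusminus> (m - 1)\<close> and \<open>\<plusminus> 2 \<i>\<close>,
  which contains the segments of all other edges.\<close>

lemma on_drawn_edge:
  assumes m: "3 \<le> m"
  shows "i < m \<Longrightarrow> z \<in> path_image (draw_edge m {i, m}) \<Longrightarrow>
      0 \<le> Im z \<and> Im z \<le> 1 \<and> Re z = (1 - Im z) * (2 * real i - (real m - 1))"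
    and "i < m \<Longrightarrow> z \<in> path_image (draw_edge m {i, Suc m}) \<Longrightarrow>
      - 1 \<le> Im z \<and> Im z \<le> 0 \<and> Re z = (1 + Im z) * (2 * real i - (real m - 1))"
    and "Suc i < m \<Longrightarrow> z \<in> path_image (draw_edge m {i, Suc i}) \<Longrightarrow>
      Im z = 0 \<and> 2 * real i - (real m - 1) \<le> Re z \<and> Re z \<le> 2 * real i + 2 - (real m - 1)"
    and "z \<in> path_image (draw_edge m {0, m - 1}) \<Longrightarrow>
      0 \<le> Im z \<and> \<bar>Re z\<bar> = (real m - 1) * (1 - Im z / 2)"
proof -
  show "0 \<le> Im z \<and> Im z \<le> 1 \<and> Re z = (1 - Im z) * (2 * real i - (real m - 1))"
    if "i < m" "z \<in> path_image (draw_edge m {i, m})"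
    using that by (auto simp: draw_edge_simps[OF m] in_segment Re_place Im_place)
  show "- 1 \<le> Im z \<and> Im z \<le> 0 \<and> Re z = (1 + Im z) * (2 * real i - (real m - 1))"
    if "i < m" "z \<in> path_image (draw_edge m {i, Suc m})"
    using that by (auto simp: draw_edge_simps[OF m] in_segment Re_place Im_place)
  show "Im z = 0 \<and> 2 * real i - (real m - 1) \<le> Re z \<and> Re z \<le> 2 * real i + 2 - (real m - 1)"
    if i: "Suc i < m" "z \<in> path_image (draw_edge m {i, Suc i})"
  proof -
    obtain u where u: "0 \<le> u" "u \<le> 1" "z = (1 - u) *\<^sub>R place m i + u *\<^sub>R place m (Suc i)"
      using i by (auto simp: draw_edge_simps[OF m] in_segment)
    have "Im z = 0" "Re z = 2 * real i + 2 * u - (real m - 1)"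
      unfolding u(3) using i(1) by (simp_all add: Re_place Im_place algebra_simps)
    then show ?thesis
      using u(1,2) by simp
  qed
  show "0 \<le> Im z \<and> \<bar>Re z\<bar> = (real m - 1) * (1 - Im z / 2)"
    if "z \<in> path_image (draw_edge m {0, m - 1})"
  proof -
    have "z \<in> closed_segment (place m 0) (2 * \<i>) \<or> z \<in> closed_segment (2 * \<i>) (place m (m - 1))"
      using that unfolding draw_edge_simps(4)[OF m] by (simp add: path_image_join)
    then obtain t where t: "0 \<le> t" "t \<le> 1" "Im z = 2 * t"
      "Re z = (1 - t) * (real m - 1) \<or> Re z = - ((1 - t) * (real m - 1))"
    proof
      assume "z \<in> closed_segment (place m 0) (2 * \<i>)"
      then obtain u where u: "0 \<le> u" "u \<le> 1" "z = (1 - u) *\<^sub>R place m 0 + u *\<^sub>R (2 * \<i>)"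
        by (auto simp: in_segment)
      have "Im z = 2 * u" "Re z = - ((1 - u) * (real m - 1))"
        unfolding u(3) using m by (simp_all add: Re_place Im_place algebra_simps)
      then show thesis
        using that[of u] u(1,2) by blast
    next
      assume "z \<in> closed_segment (2 * \<i>) (place m (m - 1))"
      then obtain u where u: "0 \<le> u" "u \<le> 1" "z = (1 - u) *\<^sub>R (2 * \<i>) + u *\<^sub>R place m (m - 1)"
        by (auto simp: in_segment)
      have "Im z = 2 * (1 - u)" "Re z = (1 - (1 - u)) * (real m - 1)"
        unfolding u(3) using m by (simp_all add: Re_place Im_place algebra_simps of_nat_diff)
      then show thesis
        using that[of "1 - u"] u(1,2) by simp
    qed
    have "0 \<le> (1 - t) * (real m - 1)"
      using t m by simp
    with t show ?thesis
      by (auto simp: algebra_simps)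
  qed
qed

lemma arc_draw_edge:
  assumes "3 \<le> m" "e \<in> edges (double_wheel m)"
  shows "arc (draw_edge m e) \<and>
    {pathstart (draw_edge m e), pathfinish (draw_edge m e)} = place m ` e"
  using assms(2,1)
proof (cases rule: double_wheel_edge_cases)
  case (upper i)
  then show ?thesis
    using assms(1) by (auto simp: draw_edge_simps complex_eq_iff Re_place Im_place place_def intro!: arc_linepath)
next
  case (lower i)
  then show ?thesis
    using assms(1) by (auto simp: draw_edge_simps complex_eq_iff Re_place Im_place place_def intro!: arc_linepath)
next
  case (axis i)
  then show ?thesis
    using assms(1) by (auto simp: draw_edge_simps complex_eq_iff Re_place Im_place intro!: arc_linepath)
next
  case closing
  let ?a = "place m 0" and ?b = "place m (m - 1)"
  have ab: "?a \<noteq> 2 * \<i>" "2 * \<i> \<noteq> ?b"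
    using assms(1) by (auto simp: complex_eq_iff Re_place Im_place)
  have "closed_segment ?a (2 * \<i>) \<inter> closed_segment (2 * \<i>) ?b \<subseteq> {2 * \<i>}"
  proof
    fix z assume "z \<in> closed_segment ?a (2 * \<i>) \<inter> closed_segment (2 * \<i>) ?b"
    then obtain u v where uv: "0 \<le> u" "u \<le> 1" "z = (1 - u) *\<^sub>R ?a + u *\<^sub>R (2 * \<i>)"
      "0 \<le> v" "v \<le> 1" "z = (1 - v) *\<^sub>R (2 * \<i>) + v *\<^sub>R ?b"
      by (auto simp: in_segment)
    have "Im z = 2 * u"
      using uv(3) assms(1) by (simp add: Im_place)
    moreover have "Im z = 2 * (1 - v)"
      using uv(6) assms(1) by (simp add: Im_place)
    moreover have "Re z = - ((1 - u) * (real m - 1))"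
      unfolding uv(3) using assms(1) by (simp add: Re_place algebra_simps)
    moreover have "Re z = v * (real m - 1)"
      using uv(6) assms(1) by (simp add: Re_place of_nat_diff)
    moreover have "1 - u = v"
      using calculation by simp
    ultimately have "v * (real m - 1) = 0"
      by simp
    then have "v = 0"
      using assms(1) by simp
    then show "z \<in> {2 * \<i>}"
      using uv(6) by simp
  qed
  then have "arc (linepath ?a (2 * \<i>) +++ linepath (2 * \<i>) ?b)"
    using ab by (intro arc_join arc_linepath) auto
  then show ?thesis
    unfolding closing draw_edge_simps(4)[OF assms(1)] by simp
qed

text \<open>Spokes at the same hub lie on different lines through that hub; arcs on different sides of the
  real axis can only meet on the axis; and on the axis the arcs reduce to vertices or to
  the successive intervals of the rim path. The one estimate concerns an upper spoke and the bent edge: at height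
  \<open>y\<close> the spoke stays within distance \<open>(1 - y) (m - 1)\<close> of the imaginary axis, the bent edge is at
  distance \<open>(1 - y / 2) (m - 1)\<close>, so they can only meet at \<open>y = 0\<close>.\<close>

lemma drawn_edges_meet_in_ends:
  assumes m: "3 \<le> m" and e: "e \<in> edges (double_wheel m)" and f: "f \<in> edges (double_wheel m)"
    and "e \<noteq> f" and ze: "z \<in> path_image (draw_edge m e)" and zf: "z \<in> path_image (draw_edge m f)"
  shows "z \<in> place m ` e"
  using e m
proof (cases rule: double_wheel_edge_cases)
  case (upper i)
  have z: "0 \<le> Im z" "Im z \<le> 1" "Re z = (1 - Im z) * (2 * real i - (real m - 1))"
    using on_drawn_edge(1)[OF m] upper ze by auto
  have "z = place m i \<or> z = place m m"
    using f m
  proof (cases rule: double_wheel_edge_cases)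
    case u: (upper j)
    then have "Re z = (1 - Im z) * (2 * real j - (real m - 1))" "i \<noteq> j"
      using on_drawn_edge(1)[OF m] zf upper \<open>e \<noteq> f\<close> by auto
    then have "Im z = 1"
      using z(3) by auto
    then show ?thesis
      using z by (simp add: eq_place_iff)
  next
    case (lower j)
    then have "Im z = 0"
      using z on_drawn_edge(2)[OF m] zf by fastforce
    then show ?thesis
      using z upper by (simp add: eq_place_iff)
  next
    case (axis j)
    then show ?thesis
      using z upper on_drawn_edge(3)[OF m] zf by (simp add: eq_place_iff)
  next
    case closing
    \<comment> \<open>The spoke is strictly inside the rhombus above the axis.\<close>
    have "\<bar>Re z\<bar> \<le> (1 - Im z) * (real m - 1)"
      unfolding z(3) abs_mult using z(1,2) \<open>i < m\<close> by (intro mult_mono) auto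
    moreover have "\<bar>Re z\<bar> = (real m - 1) * (1 - Im z / 2)"
      using closing on_drawn_edge(4)[OF m] zf by simp
    ultimately have "Im z * (real m - 1) \<le> 0"
      by (simp add: field_simps)
    then have "Im z = 0"
      using z(1) m by (auto simp: mult_le_0_iff)
    then show ?thesis
      using z upper by (simp add: eq_place_iff)
  qed
  then show ?thesis
    using upper by auto
next
  case (lower i)
  have z: "- 1 \<le> Im z" "Im z \<le> 0" "Re z = (1 + Im z) * (2 * real i - (real m - 1))"
    using on_drawn_edge(2)[OF m] lower ze by auto
  have "z = place m i \<or> z = place m (Suc m)"
  proof (cases "Im z = 0")
    case True
    then show ?thesis
      using z lower by (simp add: eq_place_iff)
  next
    case False
    from f m obtain j where "i \<noteq> j" "j < m" "f = {j, Suc m}"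
    proof (cases rule: double_wheel_edge_cases)
      case (upper j)
      then show ?thesis
        using on_drawn_edge(1)[OF m] z zf False by fastforce
    next
      case (lower j)
      then show ?thesis
        using \<open>e = {i, Suc m}\<close> \<open>e \<noteq> f\<close> by (intro that[of j]) auto
    next
      case (axis j)
      then show ?thesis
        using on_drawn_edge(3)[OF m] z zf False by fastforce
    next
      case closing
      then show ?thesis
        using on_drawn_edge(4)[OF m] z zf False by fastforce
    qed
    then have "Re z = (1 + Im z) * (2 * real j - (real m - 1))" "i \<noteq> j"
      using on_drawn_edge(2)[OF m] zf by auto
    then have "Im z = - 1"
      using z(3) by auto
    then show ?thesis
      using z by (simp add: eq_place_iff)
  qed
  then show ?thesis
    using lower by auto
next
  case (axis i)
  have z: "Im z = 0" "2 * real i - (real m - 1) \<le> Re z" "Re z \<le> 2 * real i + 2 - (real m - 1)"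
    using on_drawn_edge(3)[OF m] axis ze by auto
  have at_vertex: "z = place m i \<or> z = place m (Suc i)"
    if "j < m" "Re z = 2 * real j - (real m - 1)" for j
  proof -
    have "j = i \<or> j = Suc i"
      using that(2) z by linarith
    then show ?thesis
      using that z by (auto simp: eq_place_iff)
  qed
  have "z = place m i \<or> z = place m (Suc i)"
    using f m
  proof (cases rule: double_wheel_edge_cases)
    case (upper j)
    then show ?thesis
      using on_drawn_edge(1)[OF m] z zf by (intro at_vertex[of j]) auto
  next
    case (lower j)
    then show ?thesis
      using on_drawn_edge(2)[OF m] z zf by (intro at_vertex[of j]) auto
  next
    case ax: (axis j)
    then have "i \<noteq> j"
      using axis \<open>e \<noteq> f\<close> by auto
    moreover have "2 * real j - (real m - 1) \<le> Re z" "Re z \<le> 2 * real j + 2 - (real m - 1)"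
      using on_drawn_edge(3)[OF m] ax zf by auto
    ultimately have "Re z = 2 * real (max i j) - (real m - 1)"
      using z by (auto simp: max_def)
    then show ?thesis
      using ax axis by (intro at_vertex[of "max i j"]) auto
  next
    case closing
    then have "\<bar>Re z\<bar> = real m - 1"
      using on_drawn_edge(4)[OF m] z zf by auto
    then have "Re z = 2 * real 0 - (real m - 1) \<or> Re z = 2 * real (m - 1) - (real m - 1)"
      using m by (auto simp: of_nat_diff)
    then show ?thesis
      using m at_vertex[of 0] at_vertex[of "m - 1"] by auto
  qed
  then show ?thesis
    using axis by auto
next
  case closing
  have z: "0 \<le> Im z" "\<bar>Re z\<bar> = (real m - 1) * (1 - Im z / 2)"
    using on_drawn_edge(4)[OF m] closing ze by auto
  have "Im z = 0"
    using f m
  proof (cases rule: double_wheel_edge_cases)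
    case (upper j)
    then have zj: "Im z \<le> 1" "Re z = (1 - Im z) * (2 * real j - (real m - 1))"
      using on_drawn_edge(1)[OF m] zf by auto
    have "\<bar>Re z\<bar> \<le> (1 - Im z) * (real m - 1)"
      unfolding zj(2) abs_mult using z(1) zj(1) \<open>j < m\<close> by (intro mult_mono) auto
    then have "Im z * (real m - 1) \<le> 0"
      unfolding z(2) by (simp add: field_simps)
    then show ?thesis
      using z(1) m by (auto simp: mult_le_0_iff)
  next
    case (lower j)
    then show ?thesis
      using on_drawn_edge(2)[OF m] z zf by fastforce
  next
    case (axis j)
    then show ?thesis
      using on_drawn_edge(3)[OF m] zf by fastforce
  next
    case c: closing
    then show ?thesis
      using closing \<open>e \<noteq> f\<close> by simp
  qed
  then have "z = place m 0 \<or> z = place m (m - 1)"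
    using z m by (auto simp: eq_place_iff of_nat_diff)
  then show ?thesis
    using closing by auto
qed

text \<open>Every vertex has degree at least two. Thus a vertex lying on the drawing of \<open>e\<close> is a common
  point of \<open>e\<close> and of another edge, so that the condition on vertices in a plane drawing follows
  from the condition on pairs of edges.\<close>

lemma vertex_on_other_edge:
  assumes "3 \<le> m" "v < m + 2"
  obtains f where "f \<in> edges (double_wheel m)" "f \<noteq> e" "v \<in> f"
proof -
  have "\<exists>f g. f \<in> edges (double_wheel m) \<and> g \<in> edges (double_wheel m) \<and> f \<noteq> g \<and> v \<in> f \<and> v \<in> g"
  proof (cases "v < m")
    case True
    then show ?thesis
      by (intro exI[of _ "{v, m}"] exI[of _ "{v, Suc m}"])
        (auto simp: spoke_in_edges doubleton_eq_iff)
  next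
    case False
    then have "v = m \<or> v = Suc m"
      using assms by auto
    then show ?thesis
      using assms(1)
      by (intro exI[of _ "{0, v}"] exI[of _ "{1, v}"]) (auto simp: spoke_in_edges doubleton_eq_iff)
  qed
  then show thesis
    using that by metis
qed

lemma planar_double_wheel:
  assumes m: "3 \<le> m"
  shows "planar (double_wheel m)"
proof -
  have "plane_drawing (double_wheel m) (place m) (draw_edge m)"
    unfolding plane_drawing_def
  proof (intro conjI ballI impI)
    show "inj_on (place m) (verts (double_wheel m))"
      using inj_on_place by simp
  next
    fix e assume e: "e \<in> edges (double_wheel m)"
    show "arc (draw_edge m e)"
      and "{pathstart (draw_edge m e), pathfinish (draw_edge m e)} = place m ` e"
      using arc_draw_edge[OF m e] by auto
    show "(path_image (draw_edge m e) - place m ` e) \<inter> place m ` verts (double_wheel m) = {}"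
    proof -
      have "place m v \<in> place m ` e" if v: "v < m + 2" "place m v \<in> path_image (draw_edge m e)" for v
      proof -
        obtain f where f: "f \<in> edges (double_wheel m)" "f \<noteq> e" "v \<in> f"
          using vertex_on_other_edge[OF m v(1)] .
        have "place m v \<in> {pathstart (draw_edge m f), pathfinish (draw_edge m f)}"
          using arc_draw_edge[OF m f(1)] f(3) by blast
        then have "place m v \<in> path_image (draw_edge m f)"
          by auto
        then show ?thesis
          using drawn_edges_meet_in_ends[OF m e f(1)] f(2) v(2) by blast
      qed
      then show ?thesis
        by auto
    qed
    show "(path_image (draw_edge m e) - place m ` e) \<inter> path_image (draw_edge m f) = {}"
      if "f \<in> edges (double_wheel m)" "f \<noteq> e" for f
      using drawn_edges_meet_in_ends[OF m e that(1)] that(2) by blast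
  qed
  then show ?thesis
    by (auto simp: planar_def)
qed

section \<open>Connectivity\<close>

lemma rtrancl_along_interval:
  fixes a b :: nat
  assumes "a \<le> b" "\<And>i. a \<le> i \<Longrightarrow> i < b \<Longrightarrow> (i, Suc i) \<in> R"
  shows "(a, b) \<in> R\<^sup>*"
  using assms by (induction b rule: dec_induct) (auto intro: rtrancl_into_rtrancl)

lemma graph_connectedI:
  assumes "r \<in> verts G"
    and "\<And>v. v \<in> verts G \<Longrightarrow> (r, v) \<in> {(x, y). {x, y} \<in> edges G}\<^sup>*"
  shows "graph_connected G"
proof -
  let ?R = "{(x, y). {x, y} \<in> edges G}"
  have "sym (?R\<^sup>*)"
    by (rule sym_rtrancl) (auto simp: sym_def insert_commute)
  then have "(u, v) \<in> ?R\<^sup>*" if "u \<in> verts G" "v \<in> verts G" for u v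
    using assms(2)[OF that(1)] assms(2)[OF that(2)] by (meson rtrancl_trans symD)
  then show ?thesis
    using assms(1) by (auto simp: graph_connected_def)
qed

text \<open>A surviving hub is joined to all surviving rim vertices, and through any of these to the
  other hub.\<close>

lemma connected_hub_removal:
  assumes h: "h \<in> {m, Suc m}" "h \<notin> X" and X: "\<not> {..<m} \<subseteq> X"
  shows "graph_connected (remove_verts (double_wheel m) X)"
proof (rule graph_connectedI)
  let ?G = "remove_verts (double_wheel m) X"
  let ?R = "{(x, y). {x, y} \<in> edges ?G}"
  show "h \<in> verts ?G"
    using h by (auto simp: remove_verts_def)
  have spoke: "(w, v) \<in> ?R" "(v, w) \<in> ?R"
    if "v < m" "v \<notin> X" "w \<in> {m, Suc m}" "w \<notin> X" for v w
    using that by (auto simp: remove_verts_def spoke_in_edges)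
  fix v assume v: "v \<in> verts ?G"
  show "(h, v) \<in> ?R\<^sup>*"
  proof (cases "v < m")
    case True
    then show ?thesis
      using spoke(1)[of v h] v h by (auto simp: remove_verts_def)
  next
    case False
    obtain u where "u < m" "u \<notin> X"
      using X by auto
    moreover have "v \<in> {m, Suc m}" "v \<notin> X"
      using False v by (auto simp: remove_verts_def)
    ultimately have "(h, u) \<in> ?R" "(u, v) \<in> ?R"
      using spoke(1)[of u h] spoke(2)[of u v] h by blast+
    then show ?thesis
      by (meson converse_rtrancl_into_rtrancl r_into_rtrancl)
  qed
qed

text \<open>Without the hubs and at most one rim vertex, what is left of the rim is a cycle or a path.\<close>

lemma connected_rim_removal:
  assumes m: "3 \<le> m" and h: "{m, Suc m} \<subseteq> X" and X: "X \<inter> {..<m} \<subseteq> {x}"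
  shows "graph_connected (remove_verts (double_wheel m) X)"
proof -
  let ?G = "remove_verts (double_wheel m) X"
  let ?R = "{(x, y). {x, y} \<in> edges ?G}"
  have verts: "v \<in> verts ?G \<longleftrightarrow> v < m \<and> v \<notin> X" for v
  proof (cases "v \<in> X")
    case False
    then have "v \<noteq> m" "v \<noteq> Suc m"
      using h by blast+
    then have "v < m + 2 \<longleftrightarrow> v < m"
      by linarith
    then show ?thesis
      by (simp add: remove_verts_def)
  qed (simp add: remove_verts_def)
  have step: "(i, Suc i) \<in> ?R" if "Suc i < m" "i \<notin> X" "Suc i \<notin> X" for i
    using that rim_edge_in_edges[of i m] by (simp add: remove_verts_def)
  have jump: "(m - 1, 0) \<in> ?R" if "0 \<notin> X" "m - 1 \<notin> X"
    using that m rim_edge_in_edges[of "m - 1" m] by (simp add: remove_verts_def)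
  have sym: "sym (?R\<^sup>*)"
    by (rule sym_rtrancl, rule symI) (simp add: insert_commute)
  have up: "(0, v) \<in> ?R\<^sup>*" if "v < m" "\<And>i. i \<le> v \<Longrightarrow> i \<notin> X" for v
    using that(1) by (intro rtrancl_along_interval step that(2)) simp_all
  have down: "(m - 1, v) \<in> ?R\<^sup>*" if "v < m" "\<And>i. v \<le> i \<Longrightarrow> i < m \<Longrightarrow> i \<notin> X" for v
  proof -
    have "(v, m - 1) \<in> ?R\<^sup>*"
      using that(1) by (intro rtrancl_along_interval step that(2)) simp_all
    then show ?thesis
      by (rule symD[OF sym])
  qed
  have rim_X: "i \<notin> X" if "i < m" "i \<noteq> x" for i
    using X that by blast
  show ?thesis
  proof (cases "0 \<in> X")
    case True
    then have "x = 0"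
      using X m by auto
    show ?thesis
    proof (rule graph_connectedI)
      show "m - 1 \<in> verts ?G"
        using rim_X[of "m - 1"] m \<open>x = 0\<close> by (simp add: verts)
      show "(m - 1, v) \<in> ?R\<^sup>*" if v: "v \<in> verts ?G" for v
      proof (rule down)
        show "v < m"
          using v by (simp add: verts)
        show "i \<notin> X" if "v \<le> i" "i < m" for i
          using that v \<open>x = 0\<close> rim_X True by (cases "i = 0") (auto simp: verts)
      qed
    qed
  next
    case False
    show ?thesis
    proof (rule graph_connectedI)
      show "0 \<in> verts ?G"
        using False m by (simp add: verts)
      show "(0, v) \<in> ?R\<^sup>*" if "v \<in> verts ?G" for v
      proof -
        have v: "v < m" "v \<notin> X"
          using that by (auto simp: verts)
        show ?thesis
        proof (cases "x \<in> X \<and> x < v")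
          case True
          then have above: "i \<notin> X" if "v \<le> i" "i < m" for i
            using that by (intro rim_X) auto
          have "(m - 1, 0) \<in> ?R"
            using False above[of "m - 1"] v by (intro jump) auto
          then have "(0, m - 1) \<in> ?R\<^sup>*"
            using symD[OF sym] by blast
          then show ?thesis
            using down[OF v(1) above] by (rule rtrancl_trans)
        next
          case c: False
          have "i \<notin> X" if "i \<le> v" for i
            using that c v rim_X[of i] by (cases "i = x"; cases "i = v") auto
          then show ?thesis
            using up v by blast
        qed
      qed
    qed
  qed
qed

lemma four_connected_double_wheel:
  assumes m: "4 \<le> m"
  shows "k_connected 4 (double_wheel m)"
proof -
  have "graph_connected (remove_verts (double_wheel m) X)"
    if X: "X \<subseteq> {..<m + 2}" "card X < 4" for X
  proof (cases "{m, Suc m} \<subseteq> X")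
    case False
    have finX: "finite X"
      using X(1) finite_subset by blast
    have rim: "\<not> {..<m} \<subseteq> X"
      using card_mono[OF finX, of "{..<m}"] X(2) m by auto
    obtain h where "h \<in> {m, Suc m}" "h \<notin> X"
      using False by blast
    then show ?thesis
      using rim by (rule connected_hub_removal)
  next
    case True
    have finX: "finite X"
      using X(1) finite_subset by blast
    have "card (X \<inter> {..<m} \<union> {m, Suc m}) \<le> card X"
      using True finX by (intro card_mono) auto
    moreover have "card (X \<inter> {..<m} \<union> {m, Suc m}) = card (X \<inter> {..<m}) + card {m, Suc m}"
      using finX by (intro card_Un_disjoint) auto
    ultimately have "card (X \<inter> {..<m}) \<le> Suc 0"
      using X(2) by simp
    then obtain x where "X \<inter> {..<m} \<subseteq> {x}"
      using finX by (metis card_1_singleton_iff card_0_eq finite_Int le_Suc_eq le_zero_eq empty_subsetI subset_refl)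
    then show ?thesis
      using connected_rim_removal True m by simp
  qed
  then show ?thesis
    using m by (auto simp: k_connected_def)
qed

section \<open>Colourings\<close>

lemma proper_coloring_edge:
  assumes "proper_coloring (double_wheel m) k \<phi>" "{u, v} \<in> edges (double_wheel m)" "3 \<le> m"
  shows "\<phi> u \<noteq> \<phi> v"
proof -
  have "\<forall>e\<in>edges (double_wheel m). e \<subseteq> verts (double_wheel m) \<and> card e = 2"
    using simple_double_wheel[OF assms(3)] unfolding simple_graph_def by (rule conjunct2)
  from bspec[OF this assms(2)] have uv: "u \<in> verts (double_wheel m)" "v \<in> verts (double_wheel m)"
    by simp_all
  have "\<forall>u\<in>verts (double_wheel m). \<forall>v\<in>verts (double_wheel m).
      {u, v} \<in> edges (double_wheel m) \<longrightarrow> \<phi> u \<noteq> \<phi> v"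
    using assms(1) unfolding proper_coloring_def by (rule conjunct2)
  from bspec[OF bspec[OF this uv(1)] uv(2)] assms(2) show ?thesis
    by (rule mp)
qed

text \<open>A hub sees every rim colour. If the rim takes \<open>k - 1\<close> colours, then the only colour left for a
  hub is the missing one, which is the same for both hubs.\<close>

lemma hubs_share_colour:
  assumes m: "3 \<le> m" and \<phi>: "proper_coloring (double_wheel m) k \<phi>"
    and many: "k - 1 \<le> card (\<phi> ` {..<m})"
  shows "\<phi> m = \<phi> (Suc m)" "card (\<phi> ` {..<m}) = k - 1"
proof -
  have range: "\<phi> v \<in> {1..k}" if "v < m + 2" for v
    using \<phi> that unfolding proper_coloring_def by (simp add: Pi_iff)
  have eq: "\<phi> ` {..<m} = {1..k} - {\<phi> h}" "card ({1..k} - {\<phi> h}) = k - 1"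
    if h: "h = m \<or> h = Suc m" for h
  proof -
    have "\<phi> v \<noteq> \<phi> h" if "v < m" for v
      using proper_coloring_edge[OF \<phi> spoke_in_edges(1)[OF that] m]
        proper_coloring_edge[OF \<phi> spoke_in_edges(2)[OF that] m] h by (elim disjE) simp_all
    then have "\<phi> v \<in> {1..k} - {\<phi> h}" if "v < m" for v
      using that range[of v] by simp
    then have sub: "\<phi> ` {..<m} \<subseteq> {1..k} - {\<phi> h}"
      by (intro image_subsetI) (simp only: lessThan_iff)
    have "\<phi> h \<in> {1..k}"
      using range[of h] h by auto
    then show "card ({1..k} - {\<phi> h}) = k - 1"
      by (simp add: card_Diff_singleton)
    then show "\<phi> ` {..<m} = {1..k} - {\<phi> h}"
      using sub many by (intro card_seteq) simp_all
  qed
  have "{1..k} - {\<phi> m} = {1..k} - {\<phi> (Suc m)}"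
    using eq(1)[of m] eq(1)[of "Suc m"] by simp
  then show "\<phi> m = \<phi> (Suc m)"
  proof (rule contrapos_pp)
    assume "\<phi> m \<noteq> \<phi> (Suc m)"
    then have "\<phi> m \<in> {1..k} - {\<phi> (Suc m)}"
      using range[of m] by simp
    then show "{1..k} - {\<phi> m} \<noteq> {1..k} - {\<phi> (Suc m)}"
      by blast
  qed
  show "card (\<phi> ` {..<m}) = k - 1"
    using eq[of m] by simp
qed

lemma rim_consecutive_colours:
  assumes "proper_coloring (double_wheel m) k \<phi>" "3 \<le> m" "Suc i < m"
  shows "\<phi> i \<noteq> \<phi> (Suc i)"
  using proper_coloring_edge[OF assms(1) _ assms(2), of i "Suc i"] rim_edge_in_edges[of i m] assms(3)
  by simp

lemma rim_two_colours:
  assumes \<phi>: "proper_coloring (double_wheel m) k \<phi>" and m: "3 \<le> m"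
  shows "2 \<le> card (\<phi> ` {..<m})"
proof -
  have "card {\<phi> 0, \<phi> 1} \<le> card (\<phi> ` {..<m})"
    using m by (intro card_mono) auto
  then show ?thesis
    using rim_consecutive_colours[OF \<phi> m, of 0] m by simp
qed

text \<open>With two colours the rim would alternate along \<open>0, 1, \<dots>, m - 1\<close>, and for odd \<open>m\<close> the adjacent
  vertices \<open>0\<close> and \<open>m - 1\<close> would agree.\<close>

lemma odd_rim_three_colours:
  assumes \<phi>: "proper_coloring (double_wheel m) k \<phi>" and m: "3 \<le> m" "odd m"
  shows "3 \<le> card (\<phi> ` {..<m})"
proof (rule ccontr)
  assume few: "\<not> 3 \<le> card (\<phi> ` {..<m})"
  have ne: "\<phi> i \<noteq> \<phi> (Suc i)" if "Suc i < m" for i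
    using rim_consecutive_colours[OF \<phi> m(1) that] .
  have "{\<phi> 0, \<phi> 1} = \<phi> ` {..<m}"
    using few m ne[of 0] by (intro card_seteq) auto
  then have two: "\<phi> i = \<phi> 0 \<or> \<phi> i = \<phi> 1" if "i < m" for i
    using that by blast
  have alternate: "i < m \<Longrightarrow> \<phi> i = (if even i then \<phi> 0 else \<phi> 1)" for i
  proof (induction i)
    case (Suc i)
    then show ?case
      using ne[of i] two[of "Suc i"] by (auto split: if_splits)
  qed auto
  have "\<phi> (m - 1) = \<phi> 0"
    using alternate[of "m - 1"] m by simp
  moreover have "{m - 1, 0} \<in> edges (double_wheel m)"
    using rim_edge_in_edges[of "m - 1" m] m(1) by simp
  then have "\<phi> (m - 1) \<noteq> \<phi> 0"
    using m(1) by (rule proper_coloring_edge[OF \<phi>])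
  ultimately show False
    by simp
qed

section \<open>Spokes in a transversal\<close>

lemma finite_transversal:
  assumes "simple_graph G" "two_cc_transversal G \<phi> E'"
  shows "finite E'"
proof -
  have "E' \<subseteq> Pow (verts G)" "finite (verts G)"
    using assms by (auto simp: simple_graph_def two_cc_transversal_def)
  then show ?thesis
    by (meson finite_Pow_iff finite_subset)
qed

lemma cycle_edges_quadrilateral:
  "cycle_edges [a, b, c, d] = {{a, b}, {b, c}, {c, d}, {d, a}}"
proof -
  have image: "cycle_edges xs = (\<lambda>i. {xs ! i, xs ! (Suc i mod length xs)}) ` {..<length xs}"
    for xs :: "'a list"
    by (auto simp: cycle_edges_def)
  have four: "{..<length [a, b, c, d]} = {0, 1, 2, 3}"
    by auto
  show ?thesis
    unfolding image four by simp
qed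

text \<open>Split the rim into the vertices with a spoke in the transversal and the others. The former
  choose distinct spokes; the latter have pairwise different colours, as two of the same colour would
  span with the hubs a two-coloured 4-cycle that is missed. Only edges off the rim are counted, so
  that a rim edge can be added on top when the rim itself has two colours.\<close>

lemma card_spokes_in_transversal:
  assumes m: "3 \<le> m" and \<phi>: "proper_coloring (double_wheel m) k \<phi>"
    and hubs: "\<phi> m = \<phi> (Suc m)" and E: "two_cc_transversal (double_wheel m) \<phi> E'"
  shows "m \<le> card (E' - cycle_edges [0..<m]) + card (\<phi> ` {..<m})"
proof -
  define A where "A = {v. v < m \<and> ({v, m} \<in> E' \<or> {v, Suc m} \<in> E')}"
  define B where "B = {v. v < m \<and> {v, m} \<notin> E' \<and> {v, Suc m} \<notin> E'}"
  have finE: "finite E'"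
    using finite_transversal[OF simple_double_wheel[OF m] E] .
  have "inj_on \<phi> B"
  proof (rule inj_onI, rule ccontr)
    fix u v assume uv: "u \<in> B" "v \<in> B" "\<phi> u = \<phi> v" "u \<noteq> v"
    note edges = cycle_edges_quadrilateral[of m u "Suc m" v]
    have quad: "cycle (double_wheel m) [m, u, Suc m, v]"
      using uv m unfolding cycle_def edges by (auto simp: B_def spoke_in_edges)
    have "\<phi> u \<noteq> \<phi> m"
      using uv proper_coloring_edge[OF \<phi> _ m, of u m] by (auto simp: B_def spoke_in_edges)
    moreover have "\<phi> ` set [m, u, Suc m, v] = {\<phi> m, \<phi> u}"
      using uv hubs by auto
    ultimately have "card (\<phi> ` set [m, u, Suc m, v]) = 2"
      by simp
    with quad have "E' \<inter> cycle_edges [m, u, Suc m, v] \<noteq> {}"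
      using E unfolding two_cc_transversal_def by blast
    then show False
      using uv unfolding edges by (simp add: B_def insert_commute[of _ u] insert_commute[of _ v])
  qed
  then have cardB: "card B \<le> card (\<phi> ` {..<m})"
    by (intro card_inj_on_le[of \<phi>]) (auto simp: B_def)
  \<comment> \<open>A spoke determines its rim vertex, so choosing one spoke per vertex of \<open>A\<close> is injective.\<close>
  let ?s = "\<lambda>v. if {v, m} \<in> E' then {v, m} else {v, Suc m}"
  have "inj_on ?s A"
    by (auto simp: inj_on_def A_def doubleton_eq_iff split: if_splits)
  moreover have "?s ` A \<subseteq> E' - cycle_edges [0..<m]"
    by (auto simp: A_def dest: rim_edge_subset split: if_splits)
  ultimately have cardA: "card A \<le> card (E' - cycle_edges [0..<m])"
    using finE by (intro card_inj_on_le[of ?s]) auto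
  have "{..<m} = A \<union> B" "A \<inter> B = {}" "finite A" "finite B"
    by (auto simp: A_def B_def)
  then have "m = card A + card B"
    by (metis card_Un_disjoint card_lessThan)
  then show ?thesis
    using cardA cardB by simp
qed

section \<open>Cycles in a double wheel\<close>

lemma cycle_vertex_neighbours:
  assumes "cycle G c" "v \<in> set c"
  obtains u w where "u \<noteq> w" "u \<in> set c" "w \<in> set c"
    "{v, u} \<in> cycle_edges c" "{v, w} \<in> cycle_edges c"
proof -
  let ?n = "length c"
  have n: "3 \<le> ?n" "distinct c"
    using assms by (auto simp: cycle_def)
  obtain i where i: "i < ?n" "v = c ! i"
    using assms(2) by (auto simp: in_set_conv_nth)
  \<comment> \<open>The cyclic predecessor of \<open>i\<close>; it differs from the successor as the cycle has length at least 3.\<close>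
  define j where "j = (if i = 0 then ?n - 1 else i - 1)"
  have j: "j < ?n" "Suc j mod ?n = i"
    using i n by (auto simp: j_def)
  have l: "Suc i mod ?n < ?n"
    using n by (intro mod_less_divisor) auto
  have "j \<noteq> Suc i mod ?n"
    using i n by (cases "Suc i = ?n") (auto simp: j_def)
  then have "c ! j \<noteq> c ! (Suc i mod ?n)"
    using n j l nth_eq_iff_index_eq by blast
  moreover have "{v, c ! j} = {c ! j, c ! (Suc j mod ?n)}"
    using i j by auto
  then have "{v, c ! j} \<in> cycle_edges c"
    unfolding cycle_edges_def using j by blast
  moreover have "{v, c ! (Suc i mod ?n)} \<in> cycle_edges c"
    unfolding cycle_edges_def using i by blast
  ultimately show thesis
    using that j l nth_mem by blast
qed

text \<open>Each vertex of a cycle inside the rim has both its rim neighbours on the cycle, so the cycle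
  runs all the way round.\<close>

lemma rim_cycle_unique:
  assumes m: "3 \<le> m" and c: "cycle (double_wheel m) c" "set c \<subseteq> {..<m}"
  shows "set c = {..<m}" "cycle_edges [0..<m] \<subseteq> cycle_edges c"
proof -
  have next_edge: "Suc v mod m \<in> set c \<and> {v, Suc v mod m} \<in> cycle_edges c" if v: "v \<in> set c" for v
  proof -
    obtain u w where uw: "u \<noteq> w" "u \<in> set c" "w \<in> set c"
      "{v, u} \<in> cycle_edges c" "{v, w} \<in> cycle_edges c"
      using cycle_vertex_neighbours[OF c(1) v] .
    have vm: "v < m" "u < m" "w < m"
      using v uw c(2) by auto
    have "{v, u} \<in> edges (double_wheel m)" "{v, w} \<in> edges (double_wheel m)"
      using uw c(1) by (auto simp: cycle_def)
    then have "u = Suc v mod m \<or> v = Suc u mod m" "w = Suc v mod m \<or> v = Suc w mod m"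
      using rim_neighbours[OF vm(1,2)] rim_neighbours[OF vm(1,3)] by blast+
    moreover have "Suc u mod m \<noteq> Suc w mod m"
      using vm uw(1) by (auto simp: mod_Suc)
    ultimately show ?thesis
      using uw by auto
  qed
  obtain v where v: "v \<in> set c"
    using c(1) by (cases c) (auto simp: cycle_def)
  then have "v < m"
    using c(2) by auto
  have reach: "(v + j) mod m \<in> set c" for j
  proof (induction j)
    case 0
    then show ?case
      using v \<open>v < m\<close> by simp
  next
    case (Suc j)
    then show ?case
      using next_edge[of "(v + j) mod m"] by (simp add: mod_Suc_eq)
  qed
  have "w \<in> set c" if "w < m" for w
    using reach[of "w + m - v"] that \<open>v < m\<close> by simp
  then show "set c = {..<m}"
    using c(2) by auto
  then show "cycle_edges [0..<m] \<subseteq> cycle_edges c"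
    using next_edge by (auto simp: mem_rim_edges)
qed

text \<open>Let \<open>E'\<close> contain the spokes to the hub \<open>m\<close> from all rim vertices outside \<open>B\<close>, where \<open>B\<close> has at most one vertex
  of each colour. On a two-coloured cycle through a hub, both cycle neighbours of a rim vertex are
  hubs. If the cycle avoids \<open>E'\<close>, its rim vertices thus all lie in \<open>B\<close>; having the same colour, they
  are a single vertex, but the hub has two neighbours on the cycle.\<close>

lemma avoiding_cycle_in_rim:
  assumes m: "3 \<le> m" and \<phi>: "proper_coloring (double_wheel m) k \<phi>"
    and hubs: "\<phi> m = \<phi> (Suc m)" and B: "inj_on \<phi> B"
    and E: "\<And>v. v < m \<Longrightarrow> v \<notin> B \<Longrightarrow> {v, m} \<in> E'"
    and c: "cycle (double_wheel m) c" "card (\<phi> ` set c) = 2" "E' \<inter> cycle_edges c = {}"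
  shows "set c \<subseteq> {..<m}"
proof (rule ccontr)
  assume "\<not> set c \<subseteq> {..<m}"
  then obtain h where h: "h \<in> set c" "m \<le> h"
    by (meson lessThan_iff not_less subsetI)
  have edge: "e \<in> edges (double_wheel m)" if "e \<in> cycle_edges c" for e
    using c(1) that by (auto simp: cycle_def)
  obtain u w where uw: "u \<noteq> w" "u \<in> set c" "w \<in> set c"
    "{h, u} \<in> cycle_edges c" "{h, w} \<in> cycle_edges c"
    using cycle_vertex_neighbours[OF c(1) h(1)] .
  have \<phi>h: "\<phi> h = \<phi> m"
    using hub_neighbour(2)[OF m edge[OF uw(4)] h(2)] hubs by auto
  have ne: "\<phi> x \<noteq> \<phi> m" if "x < m" for x
    using proper_coloring_edge[OF \<phi> spoke_in_edges(1)[OF that] m] .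
  obtain a b where "\<phi> ` set c = {a, b}"
    using c(2) by (auto simp: card_2_iff)
  then have two: "\<phi> x = a \<or> \<phi> x = b" if "x \<in> set c" for x
    using that by blast
  have same: "\<phi> x = \<phi> y" if "x \<in> set c" "y \<in> set c" "\<phi> x \<noteq> \<phi> m" "\<phi> y \<noteq> \<phi> m" for x y
    using two[OF that(1)] two[OF that(2)] two[OF h(1)] that \<phi>h by auto
  have in_B: "x \<in> B" if x: "x \<in> set c" "x < m" for x
  proof -
    obtain y z where yz: "y \<noteq> z" "y \<in> set c" "z \<in> set c"
      "{x, y} \<in> cycle_edges c" "{x, z} \<in> cycle_edges c"
      using cycle_vertex_neighbours[OF c(1) x(1)] .
    have hub: "y' = m \<or> y' = Suc m" if "y' \<in> set c" "{x, y'} \<in> cycle_edges c" for y'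
    proof -
      have "\<phi> x \<noteq> \<phi> y'"
        using proper_coloring_edge[OF \<phi> edge[OF that(2)] m] .
      then have "\<not> y' < m"
        using same[OF x(1) that(1)] ne[OF x(2)] ne[of y'] by auto
      moreover have "y' < m + 2"
        using that(1) c(1) by (auto simp: cycle_def)
      ultimately show ?thesis
        by auto
    qed
    have "{x, m} \<in> cycle_edges c"
      using hub[OF yz(2,4)] hub[OF yz(3,5)] yz by auto
    then show ?thesis
      using E[OF x(2)] c(3) by auto
  qed
  have "u < m" "w < m"
    using hub_neighbour(1)[OF m _ h(2)] edge uw by auto
  then have "\<phi> u = \<phi> w" "u \<in> B" "w \<in> B"
    using same uw ne in_B by auto
  then show False
    using B uw(1) by (auto dest: inj_onD)
qed

section \<open>Transversal numbers of double wheels\<close>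

lemma two_cc_number_eqI:
  assumes "proper_coloring G k \<phi>" "two_cc_transversal G \<phi> E'" "card E' = n"
    and "\<And>\<phi> E'. proper_coloring G k \<phi> \<Longrightarrow> two_cc_transversal G \<phi> E' \<Longrightarrow> n \<le> card E'"
  shows "two_cc_number k G = enat n"
  unfolding two_cc_number_def
proof (rule antisym)
  show "Inf {enat (card E') |\<phi> E'. proper_coloring G k \<phi> \<and> two_cc_transversal G \<phi> E'} \<le> enat n"
    using assms(1-3) by (intro Inf_lower) blast
  show "enat n \<le> Inf {enat (card E') |\<phi> E'. proper_coloring G k \<phi> \<and> two_cc_transversal G \<phi> E'}"
    using assms(4) by (intro Inf_greatest) auto
qed

lemma proper_coloring_double_wheelI:
  assumes "3 \<le> m" "\<And>v. v < m + 2 \<Longrightarrow> \<phi> v \<in> {1..k}"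
    and "\<And>v. Suc v < m \<Longrightarrow> \<phi> v \<noteq> \<phi> (Suc v)" "\<phi> (m - 1) \<noteq> \<phi> 0"
    and "\<And>v. v < m \<Longrightarrow> \<phi> v \<noteq> \<phi> m" "\<And>v. v < m \<Longrightarrow> \<phi> v \<noteq> \<phi> (Suc m)"
  shows "proper_coloring (double_wheel m) k \<phi>"
proof -
  have "\<phi> u \<noteq> \<phi> v" if "{u, v} \<in> edges (double_wheel m)" for u v
    using that assms(1)
  proof (cases rule: double_wheel_edge_cases)
    case (upper i)
    then show ?thesis
      using assms(5)[of i] by (auto simp: doubleton_eq_iff)
  next
    case (lower i)
    then show ?thesis
      using assms(6)[of i] by (auto simp: doubleton_eq_iff)
  next
    case (axis i)
    then show ?thesis
      using assms(3)[of i] by (auto simp: doubleton_eq_iff)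
  next
    case closing
    then show ?thesis
      using assms(4) by (auto simp: doubleton_eq_iff)
  qed
  then show ?thesis
    using assms(2) by (auto simp: proper_coloring_def)
qed

lemma card_spokes: "card ((\<lambda>v. {v, m}) ` V) = card V" if "V \<subseteq> {..<m}" for m :: nat
  using that by (intro card_image) (auto simp: inj_on_def doubleton_eq_iff)

lemma two_cc_number_4_odd_double_wheel:
  assumes m: "3 \<le> m" "odd m"
  shows "two_cc_number 4 (double_wheel m) = enat (m - 3)"
proof -
  \<comment> \<open>Parity along the rim, corrected by a third colour at its last vertex.\<close>
  define \<phi> :: "nat \<Rightarrow> nat" where
    "\<phi> v = (if m \<le> v then 4 else if v = m - 1 then 3 else if even v then 1 else 2)" for v
  \<comment> \<open>The spared rim vertices \<open>0\<close>, \<open>1\<close>, \<open>m - 1\<close> represent the three rim colours.\<close>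
  define E' where "E' = (\<lambda>v. {v, m}) ` {2..<m - 1}"
  have \<phi>: "proper_coloring (double_wheel m) 4 \<phi>"
    using m by (intro proper_coloring_double_wheelI) (auto simp: \<phi>_def)
  have "card E' = m - 3"
    unfolding E'_def by (subst card_spokes) auto
  moreover have "two_cc_transversal (double_wheel m) \<phi> E'"
    unfolding two_cc_transversal_def
  proof (intro conjI allI impI notI)
    show "E' \<subseteq> edges (double_wheel m)"
      by (auto simp: E'_def spoke_in_edges)
    fix c assume c: "cycle (double_wheel m) c \<and> card (\<phi> ` set c) = 2"
      and avoid: "E' \<inter> cycle_edges c = {}"
    have "set c \<subseteq> {..<m}"
    proof (rule avoiding_cycle_in_rim[OF m(1) \<phi>])
      show "inj_on \<phi> {0, 1, m - 1}"
        using m by (auto simp: \<phi>_def)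
      show "{v, m} \<in> E'" if "v < m" "v \<notin> {0, 1, m - 1}" for v
        using that by (auto simp: E'_def)
    qed (use c avoid in \<open>auto simp: \<phi>_def\<close>)
    then have "set c = {..<m}"
      using rim_cycle_unique(1)[OF m(1)] c by blast
    then show False
      using odd_rim_three_colours[OF \<phi> m] c by simp
  qed
  moreover have "m - 3 \<le> card E'"
    if \<phi>: "proper_coloring (double_wheel m) 4 \<phi>" and E: "two_cc_transversal (double_wheel m) \<phi> E'"
    for \<phi> E'
  proof -
    have many: "4 - 1 \<le> card (\<phi> ` {..<m})"
      using odd_rim_three_colours[OF \<phi> m] by simp
    have "m \<le> card (E' - cycle_edges [0..<m]) + 3"
      using card_spokes_in_transversal[OF m(1) \<phi> _ E] hubs_share_colour[OF m(1) \<phi> many] by simp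
    moreover have "card (E' - cycle_edges [0..<m]) \<le> card E'"
      using finite_transversal[OF simple_double_wheel[OF m(1)] E] by (intro card_mono) auto
    ultimately show ?thesis
      by simp
  qed
  ultimately show ?thesis
    using \<phi> by (intro two_cc_number_eqI)
qed

definition even_colour :: "nat \<Rightarrow> nat \<Rightarrow> nat" where
  "even_colour m v = (if m \<le> v then 3 else if even v then 1 else 2)"

lemma even_colouring:
  assumes "3 \<le> m" "even m"
  shows "proper_coloring (double_wheel m) 3 (even_colour m)"
  using assms by (intro proper_coloring_double_wheelI) (auto simp: even_colour_def)

lemma two_cc_number_3_even_double_wheel:
  assumes m: "3 \<le> m" "even m"
  shows "two_cc_number 3 (double_wheel m) = enat (m - 1)"
proof -
  let ?\<phi> = "even_colour m"
  note \<phi> = even_colouring[OF m]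
  \<comment> \<open>The edge \<open>{0, 1}\<close> is there to cut the rim; the spared vertices \<open>0\<close> and \<open>1\<close> represent its two colours.\<close>
  define E' where "E' = insert {0, 1} ((\<lambda>v. {v, m}) ` {2..<m})"
  have rim01: "{0, 1} \<in> cycle_edges [0..<m]"
    unfolding mem_rim_edges using m by (intro exI[of _ 0]) auto
  have "m \<notin> {0, 1}"
    using m(1) by simp
  then have "{0, 1} \<notin> (\<lambda>v. {v, m}) ` {2..<m}"
    by blast
  then have "card E' = m - 1"
    unfolding E'_def using m by (simp add: card_spokes subset_iff)
  moreover have "two_cc_transversal (double_wheel m) ?\<phi> E'"
    unfolding two_cc_transversal_def
  proof (intro conjI allI impI notI)
    have "{0, 1} \<in> edges (double_wheel m)"
      using rim01 by (simp add: double_wheel_def)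
    then show "E' \<subseteq> edges (double_wheel m)"
      by (auto simp: E'_def spoke_in_edges)
    fix c assume c: "cycle (double_wheel m) c \<and> card (?\<phi> ` set c) = 2"
      and avoid: "E' \<inter> cycle_edges c = {}"
    have "set c \<subseteq> {..<m}"
    proof (rule avoiding_cycle_in_rim[OF m(1) \<phi>])
      show "inj_on ?\<phi> {0, 1}"
        using m by (auto simp: even_colour_def)
      show "{v, m} \<in> E'" if "v < m" "v \<notin> {0, 1}" for v
        using that by (auto simp: E'_def)
    qed (use c avoid in \<open>auto simp: even_colour_def\<close>)
    then have "{0, 1} \<in> cycle_edges c"
      using rim_cycle_unique(2)[OF m(1)] c rim01 by blast
    then show False
      using avoid by (auto simp: E'_def)
  qed
  moreover have "m - 1 \<le> card E'"
    if \<phi>: "proper_coloring (double_wheel m) 3 \<phi>" and E: "two_cc_transversal (double_wheel m) \<phi> E'"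
    for \<phi> E'
  proof -
    have many: "3 - 1 \<le> card (\<phi> ` {..<m})"
      using rim_two_colours[OF \<phi> m(1)] by simp
    have two: "card (\<phi> ` {..<m}) = 2"
      using hubs_share_colour(2)[OF m(1) \<phi> many] by simp
    have spokes: "m \<le> card (E' - cycle_edges [0..<m]) + 2"
      using card_spokes_in_transversal[OF m(1) \<phi> _ E] hubs_share_colour(1)[OF m(1) \<phi> many] two by simp
    have "card (\<phi> ` set [0..<m]) = 2"
      using two by (simp add: atLeast0LessThan)
    then obtain e where "e \<in> E'" "e \<in> cycle_edges [0..<m]"
      using E rim_is_cycle[OF m(1)] unfolding two_cc_transversal_def by blast
    moreover have "finite E'"
      using finite_transversal[OF simple_double_wheel[OF m(1)] E] .
    ultimately have "card (E' - cycle_edges [0..<m]) < card E'"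
      by (intro psubset_card_mono) auto
    then show ?thesis
      using spokes by simp
  qed
  ultimately show ?thesis
    using \<phi> by (intro two_cc_number_eqI)
qed

section \<open>Infinite families\<close>

lemma graph_iso_card_verts:
  assumes "graph_iso G H"
  shows "card (verts G) = card (verts H)"
  using assms by (auto simp: graph_iso_def dest: bij_betw_same_card)

lemma infinite_double_wheels:
  assumes "inj f"
  shows "infinite (range (\<lambda>n::nat. double_wheel (f n)))"
    and "pairwise (\<lambda>G H. \<not> graph_iso G H) (range (\<lambda>n::nat. double_wheel (f n)))"
proof -
  have card: "card (verts (double_wheel m)) = m + 2" for m
    by simp
  have "inj (\<lambda>n. double_wheel (f n))"
    using card assms by (metis (mono_tags, lifting) add_right_cancel injD injI)
  then show "infinite (range (\<lambda>n::nat. double_wheel (f n)))"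
    by (rule range_inj_infinite)
  show "pairwise (\<lambda>G H. \<not> graph_iso G H) (range (\<lambda>n::nat. double_wheel (f n)))"
    using card by (auto simp: pairwise_def dest!: graph_iso_card_verts)
qed

theorem theorem16:
  "(\<exists>S :: nat ugraph set.
      infinite S \<and> pairwise (\<lambda>G H. \<not> graph_iso G H) S \<and>
      (\<forall>G\<in>S. simple_graph G \<and> k_connected 4 G \<and> planar G \<and>
             two_cc_number 4 G + 5 = enat (card (verts G)))) \<and>
   (\<exists>S :: nat ugraph set.
      infinite S \<and> pairwise (\<lambda>G H. \<not> graph_iso G H) S \<and>
      (\<forall>G\<in>S. simple_graph G \<and> colorable G 3 \<and> planar G \<and>
             two_cc_number 3 G + 3 = enat (card (verts G))))"
proof (intro conjI)
  let ?odd = "range (\<lambda>n. double_wheel (2 * n + 5))"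
  have "simple_graph G \<and> k_connected 4 G \<and> planar G \<and>
      two_cc_number 4 G + 5 = enat (card (verts G))" if G: "G \<in> ?odd" for G
  proof -
    obtain n where n: "G = double_wheel (2 * n + 5)"
      using G by blast
    define m where "m = 2 * n + 5"
    have m: "G = double_wheel m" "5 \<le> m" "odd m"
      using n by (simp_all add: m_def)
    then have "two_cc_number 4 G + 5 = enat (m - 3) + enat 5"
      by (simp add: two_cc_number_4_odd_double_wheel numeral_eq_enat)
    then show ?thesis
      using m by (simp add: simple_double_wheel four_connected_double_wheel planar_double_wheel)
  qed
  moreover have "inj (\<lambda>n::nat. 2 * n + 5)"
    by (auto simp: inj_def)
  ultimately show "\<exists>S :: nat ugraph set.
      infinite S \<and> pairwise (\<lambda>G H. \<not> graph_iso G H) S \<and>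
      (\<forall>G\<in>S. simple_graph G \<and> k_connected 4 G \<and> planar G \<and>
             two_cc_number 4 G + 5 = enat (card (verts G)))"
    using infinite_double_wheels by (intro exI[of _ ?odd] conjI) blast+
next
  let ?even = "range (\<lambda>n. double_wheel (2 * n + 4))"
  have "simple_graph G \<and> colorable G 3 \<and> planar G \<and>
      two_cc_number 3 G + 3 = enat (card (verts G))" if G: "G \<in> ?even" for G
  proof -
    obtain n where n: "G = double_wheel (2 * n + 4)"
      using G by blast
    define m where "m = 2 * n + 4"
    have m: "G = double_wheel m" "4 \<le> m" "even m"
      using n by (simp_all add: m_def)
    then have "two_cc_number 3 G + 3 = enat (m - 1) + enat 3"
      by (simp add: two_cc_number_3_even_double_wheel numeral_eq_enat)
    moreover have "colorable G 3"
      unfolding colorable_def using m even_colouring[of m] by auto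
    ultimately show ?thesis
      using m by (simp add: simple_double_wheel planar_double_wheel)
  qed
  moreover have "inj (\<lambda>n::nat. 2 * n + 4)"
    by (auto simp: inj_def)
  ultimately show "\<exists>S :: nat ugraph set.
      infinite S \<and> pairwise (\<lambda>G H. \<not> graph_iso G H) S \<and>
      (\<forall>G\<in>S. simple_graph G \<and> colorable G 3 \<and> planar G \<and>
             two_cc_number 3 G + 3 = enat (card (verts G)))"
    using infinite_double_wheels by (intro exI[of _ ?even] conjI) blast+
qed

end
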